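(* For every fixed integer $d\ge1$, both $\mathcal{D}_{\mathbb{R},d}$ and $\mathcal{D}_{\mathbb{C},d}$ are semialgebraic subsets of $\mathbb{R}^{d\times d}$.
   Context: For $\mathbb{F}\in\{\mathbb{R},\mathbb{C}\}$, $\mathcal{D}_{\mathbb{F},d}\subseteq\mathbb{R}^{d\times d}$ denotes the set of real $d\times d$ matrices that are diagonalizable over $\mathbb{F}$, i.e. similar over $\mathbb{F}$ to a diagonal matrix with entries in $\mathbb{F}$. Identify $\mathbb{R}^{d\times d}$ with $\mathbb{R}^{d^2}$. A subset of $\mathbb{R}^m$ is semialgebraic if it can be obtained from finitely many sets defined by polynomial equalities and inequalities (real coefficients) by finitely many unions, intersections, and complements. *)

theory Defs
  imports "HOL-Analysis.Analysis"
begin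

definition diagonal_matrix :: "'a::zero^'n^'n \<Rightarrow> bool" where
  "diagonal_matrix D \<longleftrightarrow> (\<forall>i j. i \<noteq> j \<longrightarrow> D $ i $ j = 0)"

definition similar_matrix :: "'a::field^'n^'n \<Rightarrow> 'a^'n^'n \<Rightarrow> bool" where
  "similar_matrix A B \<longleftrightarrow> (\<exists>P. invertible P \<and> A = P ** B ** matrix_inv P)"

definition diagonalizable :: "'a::field^'n^'n \<Rightarrow> bool" where
  "diagonalizable A \<longleftrightarrow> (\<exists>D. diagonal_matrix D \<and> similar_matrix A D)"

text \<open>
  Both sets consist of real matrices; the size \<open>d \<ge> 1\<close> is the cardinality of the
  (finite, nonempty) index type.
\<close>

definition real_diagonalizable_matrices :: "(real^'n^'n) set" where
  "real_diagonalizable_matrices = {A. diagonalizable A}"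

definition complex_diagonalizable_matrices :: "(real^'n^'n) set" where
  "complex_diagonalizable_matrices = {A. diagonalizable (map_matrix complex_of_real A)}"

text \<open>
  On a Euclidean space, \<^const>\<open>real_polynomial_function\<close> describes exactly the real polynomials
  in the coordinates, for any choice of linear coordinates. On \<open>real^'n^'n\<close> these are the
  polynomials in the matrix entries, so no explicit identification with the space of vectors
  of length \<open>d\<^sup>2\<close> is needed. The remaining kinds of inequality (\<open>\<le>\<close>, \<open>\<noteq>\<close>, \<open><\<close>)
  reduce to the two base cases by negating polynomials and complementing sets.
\<close>

inductive semialgebraic :: "'a::euclidean_space set \<Rightarrow> bool" where
  eq: "real_polynomial_function p \<Longrightarrow> semialgebraic {x. p x = 0}"
| pos: "real_polynomial_function p \<Longrightarrow> semialgebraic {x. p x > 0}"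
| Un: "semialgebraic S \<Longrightarrow> semialgebraic T \<Longrightarrow> semialgebraic (S \<union> T)"
| Int: "semialgebraic S \<Longrightarrow> semialgebraic T \<Longrightarrow> semialgebraic (S \<inter> T)"
| Compl: "semialgebraic S \<Longrightarrow> semialgebraic (- S)"

end

theory Submission
  imports Defs "HOL-Computational_Algebra.Fundamental_Theorem_Algebra"
begin

text \<open>
  The definition of diagonalizability quantifies over a change of basis. The quantifiers are
  removed by passing to the algebra \<open>\<real>[A]\<close> of polynomials in \<open>A\<close> and to the trace form
  \<open>(p, q) \<mapsto> tr (p(A) q(A))\<close> on it. The matrix \<open>A\<close> is diagonalizable over the complex numbers
  exactly if its minimal polynomial has no multiple complex root, that is, if \<open>\<real>[A]\<close> has no
  nonzero nilpotent element, and this holds exactly if the trace form is nondegenerate. It is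
  diagonalizable over the reals exactly if, in addition, all eigenvalues are real, and this holds
  exactly if the trace form is positive definite: multiplication by \<open>A\<close> is self-adjoint for it.

  Let \<open>k\<close> be the degree of the minimal polynomial. The powers \<open>A\<^sup>i\<close> with \<open>i < k\<close> are a basis of
  \<open>\<real>[A]\<close>, and in this basis the trace form is the Hankel matrix with the entries \<open>tr (A\<^sup>i\<^sup>+\<^sup>j)\<close>,
  which are polynomials in the entries of \<open>A\<close>. Its definiteness or nondegeneracy already forces
  the powers to be independent, so that \<open>k\<close> can be described as some number for which this
  condition holds and some nonzero polynomial of degree at most \<open>k\<close> annihilates \<open>A\<close>
  (\<open>real_diagonalizable_iff\<close>, \<open>complex_diagonalizable_iff\<close>). Since \<open>k\<close> is bounded by the
  dimension of the matrix space, the two sets are finite unions over \<open>k\<close>.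

  What remains is to see that these conditions on a coefficient vector of length \<open>k\<close> are
  semialgebraic in \<open>A\<close>. All of them reduce to the positive definiteness of a quadratic form with
  polynomial coefficients: a system of linear forms has only the trivial common zero if and only
  if the sum of their squares is positive definite. Positive definiteness in turn is a
  conjunction of \<open>k\<close> strict polynomial inequalities, found by completing squares
  (\<open>semialgebraic_posdef\<close>).
\<close>

section \<open>Positive definiteness as a semialgebraic condition\<close>

text \<open>
  Completing the square in the first variable: multiplying the form by its first coefficient
  gives a square plus the form \<open>a'\<close> in the other variables. Multiplying instead of dividing keeps
  the new coefficients polynomial in the old ones, so that the step can be iterated.
\<close>

lemma posdef_schur_complement:
  fixes a :: "nat \<Rightarrow> nat \<Rightarrow> real"
  assumes sym: "\<And>i j. a i j = a j i"
  defines "a' \<equiv> \<lambda>i j. a 0 0 * a (Suc i) (Suc j) - a (Suc i) 0 * a 0 (Suc j)"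
  shows "(\<forall>c. (\<exists>i<Suc k. c i \<noteq> 0) \<longrightarrow> 0 < (\<Sum>i<Suc k. \<Sum>j<Suc k. c i * c j * a i j)) \<longleftrightarrow>
         a 0 0 > 0 \<and> (\<forall>c. (\<exists>i<k. c i \<noteq> 0) \<longrightarrow> 0 < (\<Sum>i<k. \<Sum>j<k. c i * c j * a' i j))"
    (is "?L \<longleftrightarrow> ?R1 \<and> ?R2")
proof -
  define Q where "Q = (\<lambda>c. \<Sum>i<Suc k. \<Sum>j<Suc k. c i * c j * a i j)"
  define Q' where "Q' = (\<lambda>c. \<Sum>i<k. \<Sum>j<k. c i * c j * a' i j)"
  have square: "a 0 0 * Q c = (c 0 * a 0 0 + (\<Sum>j<k. c (Suc j) * a 0 (Suc j)))\<^sup>2 + Q' (\<lambda>i. c (Suc i))" for c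
  proof -
    define L where "L = (\<Sum>j<k. c (Suc j) * a 0 (Suc j))"
    define M where "M = (\<Sum>i<k. \<Sum>j<k. c (Suc i) * c (Suc j) * a (Suc i) (Suc j))"
    have Q: "Q c = c 0 * c 0 * a 0 0 + c 0 * L + (c 0 * L + M)"
      unfolding Q_def L_def M_def sum.lessThan_Suc_shift
      by (simp add: sum.distrib sum_distrib_left sym[of "Suc _" 0] mult_ac)
    have "L * L = (\<Sum>i<k. \<Sum>j<k. c (Suc i) * c (Suc j) * (a (Suc i) 0 * a 0 (Suc j)))"
      unfolding L_def sum_product by (simp add: sym[of "Suc _" 0] mult_ac)
    then have "Q' (\<lambda>i. c (Suc i)) = a 0 0 * M - L * L"
      unfolding Q'_def M_def a'_def
      by (simp add: sum_distrib_left sum_subtractf algebra_simps)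
    then show ?thesis
      unfolding Q L_def[symmetric] by (simp add: power2_eq_square algebra_simps)
  qed
  have "?R1 \<and> ?R2" if L: ?L
  proof (intro conjI allI impI)
    have "0 < Q (\<lambda>i. if i = 0 then 1 else 0)"
      unfolding Q_def by (rule L[rule_format]) auto
    then show pos: "a 0 0 > 0"
      unfolding Q_def sum.lessThan_Suc_shift by simp
    fix c :: "nat \<Rightarrow> real" assume "\<exists>i<k. c i \<noteq> 0"
    then obtain i where i: "i < k" "c i \<noteq> 0" by blast
    \<comment> \<open>Choosing the first coordinate so that the square vanishes minimises the form.\<close>
    define d where "d = case_nat (- (\<Sum>j<k. c j * a 0 (Suc j)) / a 0 0) c"
    have "d (Suc i) \<noteq> 0" "Suc i < Suc k" using i by (auto simp: d_def)
    then have "0 < Q d" using L unfolding Q_def by blast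
    then have "0 < a 0 0 * Q d" using pos by simp
    then show "0 < (\<Sum>i<k. \<Sum>j<k. c i * c j * a' i j)"
      unfolding square using pos by (simp add: d_def Q'_def)
  qed
  moreover have ?L if pos: ?R1 and R: ?R2
  proof (intro allI impI)
    fix c :: "nat \<Rightarrow> real" assume c: "\<exists>i<Suc k. c i \<noteq> 0"
    have "0 < a 0 0 * Q c"
    proof (cases "\<exists>i<k. c (Suc i) \<noteq> 0")
      case True
      then have "0 < Q' (\<lambda>i. c (Suc i))"
        unfolding Q'_def by (rule R[rule_format])
      then show ?thesis unfolding square by (simp add: add_nonneg_pos)
    next
      case False
      then have "c 0 \<noteq> 0" using c less_Suc_eq_0_disj by auto
      with False pos show ?thesis unfolding square by (simp add: Q'_def)
    qed
    then have "0 < Q c" using pos by (simp add: zero_less_mult_iff)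
    then show "0 < (\<Sum>i<Suc k. \<Sum>j<Suc k. c i * c j * a i j)" by (simp add: Q_def)
  qed
  ultimately show ?thesis by blast
qed

lemma semialgebraic_posdef:
  fixes b :: "nat \<Rightarrow> nat \<Rightarrow> 'a::euclidean_space \<Rightarrow> real"
  assumes "\<And>i j. real_polynomial_function (b i j)"
    and "\<And>i j x. b i j x = b j i x"
  shows "semialgebraic {x. \<forall>c. (\<exists>i<k. c i \<noteq> 0) \<longrightarrow> 0 < (\<Sum>i<k. \<Sum>j<k. c i * c j * b i j x)}"
  using assms
proof (induction k arbitrary: b)
  case 0
  have "semialgebraic {x::'a. (\<lambda>_. 0) x = (0::real)}"
    by (rule semialgebraic.eq) (rule real_polynomial_function.intros(2))
  then show ?case by simp
next
  case (Suc k)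
  define b' where "b' = (\<lambda>i j x. b 0 0 x * b (Suc i) (Suc j) x - b (Suc i) 0 x * b 0 (Suc j) x)"
  have 1: "semialgebraic {x. b 0 0 x > 0}"
    by (rule semialgebraic.pos) (rule Suc)
  have 2: "semialgebraic {x. \<forall>c. (\<exists>i<k. c i \<noteq> 0) \<longrightarrow> 0 < (\<Sum>i<k. \<Sum>j<k. c i * c j * b' i j x)}"
  proof (rule Suc.IH)
    show "real_polynomial_function (b' i j)" for i j
      unfolding b'_def
      by (intro real_polynomial_function_diff real_polynomial_function.intros(4) Suc.prems)
    show "b' i j x = b' j i x" for i j x
      unfolding b'_def using Suc.prems(2)[of _ _ x] by (metis mult.commute)
  qed
  have "(\<forall>c. (\<exists>i<Suc k. c i \<noteq> 0) \<longrightarrow> 0 < (\<Sum>i<Suc k. \<Sum>j<Suc k. c i * c j * b i j x)) \<longleftrightarrow>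
      b 0 0 x > 0 \<and> (\<forall>c. (\<exists>i<k. c i \<noteq> 0) \<longrightarrow> 0 < (\<Sum>i<k. \<Sum>j<k. c i * c j * b' i j x))" for x
    unfolding b'_def by (rule posdef_schur_complement) (rule Suc.prems)
  then show ?case
    using semialgebraic.Int[OF 1 2] by (simp only: Collect_conj_eq)
qed

text \<open>
  A system of linear forms has a common zero exactly where the sum of their squares vanishes,
  so the absence of a nontrivial common zero is positive definiteness of that sum.
\<close>

lemma semialgebraic_independent:
  fixes f :: "'l \<Rightarrow> nat \<Rightarrow> 'a::euclidean_space \<Rightarrow> real"
  assumes L: "finite L" and f: "\<And>l i. real_polynomial_function (f l i)"
  shows "semialgebraic {x. \<forall>c. (\<exists>i<k. c i \<noteq> 0) \<longrightarrow> (\<exists>l\<in>L. (\<Sum>i<k. c i * f l i x) \<noteq> 0)}"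
proof -
  define b where "b = (\<lambda>i j x. \<Sum>l\<in>L. f l i x * f l j x)"
  have "(\<Sum>i<k. \<Sum>j<k. c i * c j * b i j x) = (\<Sum>l\<in>L. (\<Sum>i<k. c i * f l i x)\<^sup>2)" for c x
  proof -
    have "(\<Sum>i<k. \<Sum>j<k. c i * c j * b i j x)
        = (\<Sum>i<k. \<Sum>j<k. \<Sum>l\<in>L. (c i * f l i x) * (c j * f l j x))"
      by (simp add: b_def sum_distrib_left mult_ac)
    also have "\<dots> = (\<Sum>i<k. \<Sum>l\<in>L. \<Sum>j<k. (c i * f l i x) * (c j * f l j x))"
      by (intro sum.cong refl sum.swap)
    also have "\<dots> = (\<Sum>l\<in>L. \<Sum>i<k. \<Sum>j<k. (c i * f l i x) * (c j * f l j x))"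
      by (rule sum.swap)
    also have "\<dots> = (\<Sum>l\<in>L. (\<Sum>i<k. c i * f l i x)\<^sup>2)"
      by (simp add: power2_eq_square sum_product)
    finally show ?thesis .
  qed
  moreover have "0 < (\<Sum>l\<in>L. (g l)\<^sup>2) \<longleftrightarrow> (\<exists>l\<in>L. g l \<noteq> 0)" for g :: "'l \<Rightarrow> real"
    by (simp add: order_less_le sum_nonneg sum_nonneg_eq_0_iff L eq_commute[of 0])
  moreover have "semialgebraic {x. \<forall>c. (\<exists>i<k. c i \<noteq> 0) \<longrightarrow> 0 < (\<Sum>i<k. \<Sum>j<k. c i * c j * b i j x)}"
  proof (rule semialgebraic_posdef)
    show "real_polynomial_function (b i j)" for i j
      unfolding b_def by (intro real_polynomial_function_sum real_polynomial_function.intros(4) f L)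
    show "b i j x = b j i x" for i j x
      by (simp add: b_def mult.commute)
  qed
  ultimately show ?thesis by simp
qed

lemma semialgebraic_finite_UN:
  fixes S :: "nat \<Rightarrow> 'a::euclidean_space set"
  assumes "\<And>k. semialgebraic (S k)"
  shows "semialgebraic (\<Union>k\<le>n. S k)"
  by (induction n) (simp_all add: atMost_Suc semialgebraic.Un assms)

section \<open>Polynomials evaluated at matrices\<close>

text \<open>
  Horner's scheme with respect to the matrix product \<open>**\<close>. The constant \<open>poly\<close> would need a ring
  multiplication on the type of square matrices.
\<close>

definition matpoly :: "'a::field poly \<Rightarrow> 'a^'n^'n \<Rightarrow> 'a^'n^'n" where
  "matpoly p A = fold_coeffs (\<lambda>a X. mat a + A ** X) p 0"

lemma matpoly_0 [simp]: "matpoly 0 A = 0"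
  by (simp add: matpoly_def)

lemma matpoly_pCons [simp]: "matpoly (pCons a p) A = mat a + A ** matpoly p A"
proof (cases "p = 0 \<and> a = 0")
  case False
  then have "fold_coeffs (\<lambda>a X. mat a + A ** X) (pCons a p) =
      (\<lambda>X. mat a + A ** X) \<circ> fold_coeffs (\<lambda>a X. mat a + A ** X) p"
    by (cases "p = 0") auto
  then show ?thesis unfolding matpoly_def by (simp only: o_apply)
qed (auto simp: matrix_matrix_mult_def vec_eq_iff)

lemma mat_add: "mat (a + b) = mat a + (mat b :: 'a::semiring_1^'n^'n)"
  by (simp add: mat_def vec_eq_iff)

lemma mat_mult_entry: "(mat a ** X) $ i $ j = a * X $ i $ j"
  for X :: "'a::semiring_1^'n^'m"
  by (simp add: mat_def matrix_matrix_mult_def if_distrib[of "\<lambda>x. x * _"] cong: if_cong)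

lemma mult_mat_entry: "(X ** mat a) $ i $ j = X $ i $ j * a"
  for X :: "'a::semiring_1^'n^'m"
  by (simp add: mat_def matrix_matrix_mult_def if_distrib[of "\<lambda>x. _ * x"] cong: if_cong)

lemma mat_mult: "mat (a * b) = mat a ** (mat b :: 'a::semiring_1^'n^'n)"
  unfolding vec_eq_iff mat_mult_entry by (simp add: mat_def)

lemma mat_mult_commute: "A ** mat a = mat a ** A"
  for A :: "'a::comm_semiring_1^'n^'n"
  by (simp add: vec_eq_iff mat_mult_entry mult_mat_entry mult.commute)

lemma trace_mat_mult: "trace (mat a ** X) = a * trace X"
  for X :: "'a::comm_semiring_1^'n^'n"
  by (simp add: trace_def mat_mult_entry sum_distrib_left)

lemma matrix_mult_add_left: "(A + B) ** C = A ** C + B ** C"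
  for C :: "'a::semiring_1^'n^'m"
  by (simp add: vec_eq_iff matrix_matrix_mult_def distrib_right sum.distrib)

lemma matpoly_add: "matpoly (p + q) A = matpoly p A + matpoly q A"
  by (induction p q rule: poly_induct2) (simp_all add: mat_add matrix_add_ldistrib)

lemma matpoly_smult: "matpoly (smult a p) A = mat a ** matpoly p A"
proof (induction p)
  case (pCons b p)
  have "A ** (mat a ** matpoly p A) = mat a ** (A ** matpoly p A)"
    by (simp only: matrix_mul_assoc mat_mult_commute[of A])
  with pCons show ?case by (simp add: mat_mult matrix_add_ldistrib)
qed simp

lemma matpoly_mult: "matpoly (p * q) A = matpoly p A ** matpoly q A"
  by (induction p)
     (simp_all add: matpoly_add matpoly_smult matrix_mult_add_left matrix_mul_assoc)

lemma matpoly_sum: "matpoly (sum f I) A = (\<Sum>i\<in>I. matpoly (f i) A)"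
  by (induction I rule: infinite_finite_induct) (simp_all add: matpoly_add)

lemma trace_matpoly_add: "trace (matpoly (p + q) A) = trace (matpoly p A) + trace (matpoly q A)"
  by (simp add: matpoly_add trace_add)

lemma trace_matpoly_smult: "trace (matpoly (smult a p) A) = a * trace (matpoly p A)"
  by (simp add: matpoly_smult trace_mat_mult)

lemma trace_matpoly_sum: "trace (matpoly (sum f I) A) = (\<Sum>i\<in>I. trace (matpoly (f i) A))"
  by (induction I rule: infinite_finite_induct) (simp_all add: trace_matpoly_add trace_0[simplified])

lemma
  assumes "invertible A"
  shows matrix_inv_right: "A ** matrix_inv A = mat 1"
    and matrix_inv_left: "matrix_inv A ** A = mat 1"
proof -
  have "A ** matrix_inv A = mat 1 \<and> matrix_inv A ** A = mat 1"
    using assms unfolding invertible_def matrix_inv_def by (rule someI_ex)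
  then show "A ** matrix_inv A = mat 1" "matrix_inv A ** A = mat 1" by auto
qed

lemma matpoly_similar:
  fixes P :: "'a::field^'n^'n"
  assumes P: "invertible P" and A: "A = P ** B ** matrix_inv P"
  shows "matpoly p A = P ** matpoly p B ** matrix_inv P"
proof (induction p)
  case (pCons a p)
  have "A ** (P ** X ** matrix_inv P) = P ** (B ** X) ** matrix_inv P" for X
  proof -
    have "A ** (P ** X ** matrix_inv P) = P ** B ** (matrix_inv P ** P) ** X ** matrix_inv P"
      unfolding A by (simp add: matrix_mul_assoc)
    then show ?thesis by (simp add: matrix_inv_left[OF P] matrix_mul_assoc)
  qed
  moreover have "P ** mat a ** matrix_inv P = mat a"
  proof -
    have "P ** mat a ** matrix_inv P = mat a ** (P ** matrix_inv P)"
      by (simp only: mat_mult_commute[of P] matrix_mul_assoc)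
    then show ?thesis by (simp add: matrix_inv_right[OF P])
  qed
  ultimately show ?case using pCons
    by (simp add: matrix_add_ldistrib matrix_mult_add_left)
qed simp

lemma matpoly_diagonal_matrix:
  assumes "diagonal_matrix D"
  shows "matpoly p D $ i $ j = (if i = j then poly p (D $ i $ i) else 0)"
proof (induction p arbitrary: i j)
  case (pCons a p)
  have "(D ** matpoly p D) $ i $ j = D $ i $ i * matpoly p D $ i $ j"
    unfolding matrix_matrix_mult_def
    using assms by (subst vec_lambda_beta)+ (subst sum.remove[of _ i], auto simp: diagonal_matrix_def)
  with pCons show ?case by (simp add: mat_def)
qed simp

lemma trace_matpoly_similar_diagonal:
  fixes P :: "'a::field^'n^'n"
  assumes "diagonal_matrix D" and P: "invertible P" and A: "A = P ** D ** matrix_inv P"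
  shows "trace (matpoly p A) = (\<Sum>i\<in>UNIV. poly p (D $ i $ i))"
proof -
  have "trace (matpoly p A) = trace (P ** (matpoly p D ** matrix_inv P))"
    by (simp add: matpoly_similar[OF P A] matrix_mul_assoc)
  also have "\<dots> = trace (matpoly p D ** (matrix_inv P ** P))"
    by (subst trace_mul_sym) (simp add: matrix_mul_assoc)
  finally show ?thesis
    by (simp add: matrix_inv_left[OF P] trace_def matpoly_diagonal_matrix[OF assms(1)])
qed

lemma matpoly_similar_diagonal_eq_0:
  fixes P :: "'a::field^'n^'n"
  assumes "diagonal_matrix D" and P: "invertible P" and A: "A = P ** D ** matrix_inv P"
    and "\<And>i. poly p (D $ i $ i) = 0"
  shows "matpoly p A = 0"
proof -
  have "matpoly p D = 0"
    by (simp add: vec_eq_iff matpoly_diagonal_matrix[OF assms(1)] assms(4))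
  then show ?thesis by (simp add: matpoly_similar[OF P A])
qed

lemma map_matrix_of_real_matpoly:
  "map_matrix complex_of_real (matpoly p A) =
   matpoly (map_poly of_real p) (map_matrix of_real A)"
proof (induction p)
  case (pCons a p)
  then show ?case
    by (simp add: map_poly_pCons vec_eq_iff matrix_matrix_mult_def mat_def)
qed (simp add: vec_eq_iff)

lemma trace_map_matrix_of_real: "trace (map_matrix complex_of_real X) = of_real (trace X)"
  by (simp add: trace_def)

text \<open>
  A generalized inverse \<open>X\<close>, with \<open>N X N = N\<close>, gives \<open>tr N = tr (N (X N)) = tr (X N\<^sup>2)\<close>. In this
  form nilpotent elements enter the trace criteria: those of \<open>\<real>[A]\<close> are orthogonal to all of
  \<open>\<real>[A]\<close>.
\<close>

lemma trace_square_zero: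
  fixes N :: "'a::field^'n^'n"
  assumes "N ** N = 0"
  shows "trace N = 0"
proof -
  obtain X where X: "N ** X ** N = N"
  proof -
    have "\<exists>g\<in>{g. range g \<subseteq> UNIV \<and> Vector_Spaces.linear (*s) (*s) g}. \<forall>v\<in>(*v) N ` UNIV. N *v g v = v"
      using vec.linear_exists_right_inverse_on[of "(*v) N" UNIV] by fastforce
    then obtain g where g: "Vector_Spaces.linear (*s) (*s) g" "\<And>v. N *v g (N *v v) = N *v v"
      by auto
    have "N ** matrix g ** N = N"
      by (simp add: matrix_eq matrix_vector_mul_assoc[symmetric] matrix_works[OF g(1)] g(2))
    then show ?thesis by (rule that)
  qed
  have "trace N = trace (N ** (X ** N))" using X by (simp add: matrix_mul_assoc)
  also have "\<dots> = trace (X ** (N ** N))" by (subst trace_mul_sym) (simp add: matrix_mul_assoc)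
  finally show ?thesis using assms trace_0[simplified] by simp
qed

section \<open>Annihilating polynomials and diagonalizability\<close>

text \<open>
  On an eigenvector for \<open>\<mu>\<close> the map \<open>A - \<kappa>\<close> is multiplication by \<open>\<mu> - \<kappa> \<noteq> 0\<close>. It is therefore
  surjective on a sum of eigenspaces that does not involve \<open>\<kappa>\<close>.
\<close>

lemma eigenvector_span_image:
  fixes A :: "'a::field^'n^'n"
  assumes "w \<in> vec.span (\<Union>\<mu>\<in>S. {v. A *v v = \<mu> *s v})" "\<kappa> \<notin> S"
  shows "\<exists>u \<in> vec.span (\<Union>\<mu>\<in>S. {v. A *v v = \<mu> *s v}). A *v u - \<kappa> *s u = w"
  using assms(1)
proof (induction rule: vec.span_induct_alt)
  case base
  show ?case by (rule bexI[of _ 0]) (auto simp: vec.span_zero)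
next
  case (step c x y)
  then obtain \<mu> where \<mu>: "\<mu> \<in> S" "A *v x = \<mu> *s x" by blast
  then have "\<mu> - \<kappa> \<noteq> 0" using assms(2) by auto
  from step obtain u where u: "u \<in> vec.span (\<Union>\<mu>\<in>S. {v. A *v v = \<mu> *s v})" "A *v u - \<kappa> *s u = y"
    by blast
  have "A *v ((c / (\<mu> - \<kappa>)) *s x) - \<kappa> *s ((c / (\<mu> - \<kappa>)) *s x) = c *s x"
  proof -
    have "c / (\<mu> - \<kappa>) * (\<mu> * y) - \<kappa> * (c / (\<mu> - \<kappa>) * y) = c / (\<mu> - \<kappa>) * (\<mu> - \<kappa>) * y" for y
      by (simp only: ring_distribs mult_ac)
    then show ?thesis
      using \<open>\<mu> - \<kappa> \<noteq> 0\<close> by (simp add: vec.scale \<mu>(2) vec_eq_iff mult.assoc)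
  qed
  then have "A *v ((c / (\<mu> - \<kappa>)) *s x + u) - \<kappa> *s ((c / (\<mu> - \<kappa>)) *s x + u) = c *s x + y"
    using u(2) by (simp add: matrix_vector_right_distrib vec.scale_right_distrib algebra_simps)
  moreover have "(c / (\<mu> - \<kappa>)) *s x + u \<in> vec.span (\<Union>\<mu>\<in>S. {v. A *v v = \<mu> *s v})"
    using step(1) u(1) by (intro vec.span_add vec.span_scale) (auto intro: vec.span_base)
  ultimately show ?case by blast
qed

text \<open>
  If \<open>A - \<kappa>\<close> maps \<open>v\<close> into the sum of the other eigenspaces, then that sum contains some \<open>u\<close> with
  the same image by \<open>eigenvector_span_image\<close>, and \<open>v - u\<close> is an eigenvector for \<open>\<kappa>\<close>.
\<close>

lemma kernel_subset_eigenvector_span: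
  fixes A :: "'a::field^'n^'n"
  assumes "finite S" "matpoly (\<Prod>\<mu>\<in>S. [:-\<mu>, 1:]) A *v v = 0"
  shows "v \<in> vec.span (\<Union>\<mu>\<in>S. {v. A *v v = \<mu> *s v})"
  using assms
proof (induction S arbitrary: v rule: finite_induct)
  case empty
  then show ?case by (simp add: one_pCons vec.span_zero)
next
  case (insert \<kappa> S)
  define w where "w = matpoly [:-\<kappa>, 1:] A *v v"
  have "matpoly (\<Prod>\<mu>\<in>S. [:-\<mu>, 1:]) A *v w = matpoly ((\<Prod>\<mu>\<in>S. [:-\<mu>, 1:]) * [:-\<kappa>, 1:]) A *v v"
    by (simp only: w_def matrix_vector_mul_assoc matpoly_mult)
  also have "\<dots> = matpoly (\<Prod>\<mu>\<in>insert \<kappa> S. [:-\<mu>, 1:]) A *v v"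
    by (simp only: prod.insert[OF insert(1,2)] mult.commute)
  finally have "matpoly (\<Prod>\<mu>\<in>S. [:-\<mu>, 1:]) A *v w = 0"
    using insert.prems by simp
  then have "w \<in> vec.span (\<Union>\<mu>\<in>S. {v. A *v v = \<mu> *s v})"
    by (rule insert.IH)
  then obtain u where u: "u \<in> vec.span (\<Union>\<mu>\<in>S. {v. A *v v = \<mu> *s v})" "A *v u - \<kappa> *s u = w"
    using eigenvector_span_image[OF _ insert(2)] by blast
  have "mat a *v v = a *s v" for a :: 'a
    by (simp add: vec_eq_iff matrix_vector_mult_def mat_def if_distrib[of "\<lambda>x. x * _"] cong: if_cong)
  then have "w = A *v v - \<kappa> *s v"
    by (simp add: w_def matrix_vector_mult_add_rdistrib vec_eq_iff)
  with u(2) have "A *v (v - u) = \<kappa> *s (v - u)"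
    by (simp add: matrix_vector_mult_diff_distrib vec.scale_right_diff_distrib algebra_simps)
  then have "v - u \<in> vec.span (\<Union>\<mu>\<in>insert \<kappa> S. {v. A *v v = \<mu> *s v})"
    by (intro vec.span_base) auto
  moreover have "u \<in> vec.span (\<Union>\<mu>\<in>insert \<kappa> S. {v. A *v v = \<mu> *s v})"
    using u(1) vec.span_mono[of "\<Union>\<mu>\<in>S. {v. A *v v = \<mu> *s v}" "\<Union>\<mu>\<in>insert \<kappa> S. {v. A *v v = \<mu> *s v}"]
    by blast
  ultimately have "(v - u) + u \<in> vec.span (\<Union>\<mu>\<in>insert \<kappa> S. {v. A *v v = \<mu> *s v})"
    by (rule vec.span_add)
  then show ?case by simp
qed

lemma diagonalizable_if_eigenvectors_span:
  fixes A :: "'a::field^'n^'n"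
  assumes "vec.span {v. \<exists>\<mu>. A *v v = \<mu> *s v} = UNIV"
  shows "diagonalizable A"
proof -
  obtain B where B: "B \<subseteq> {v. \<exists>\<mu>. A *v v = \<mu> *s v}" "vec.independent B"
      "{v. \<exists>\<mu>. A *v v = \<mu> *s v} \<subseteq> vec.span B"
    by (rule vec.maximal_independent_subset)
  have span: "vec.span B = UNIV"
    using vec.span_mono[OF B(3)] assms by (simp add: vec.span_span top.extremum_unique)
  have "finite B" using B(2) by (rule vec.finiteI_independent)
  moreover have "card B = CARD('n)"
    using vec.basis_card_eq_dim[of B UNIV] B(2) span by (simp add: vec.dim_UNIV card_cart_basis)
  ultimately obtain f where f: "bij_betw f (UNIV::'n set) B"
    using finite_same_card_bij[of "UNIV::'n set" B] by auto
  have "\<forall>j. \<exists>\<mu>. A *v f j = \<mu> *s f j"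
    using B(1) bij_betwE[OF f] by blast
  then obtain d where d: "\<And>j. A *v f j = d j *s f j" by metis
  define P where "P = (\<chi> i j. f j $ i)"
  define D where "D = (\<chi> i j. if i = j then d j else 0)"
  have "column j P = f j" for j by (simp add: column_def P_def vec_eq_iff)
  then have "columns P = B"
    using bij_betw_imp_surj_on[OF f] by (auto simp: columns_def image_def)
  then have P: "invertible P"
    using matrix_right_invertible_span_columns[of P] span invertible_right_inverse by blast
  have "(A ** P) $ i $ j = (P ** D) $ i $ j" for i j
  proof -
    have "(A ** P) $ i $ j = (A *v f j) $ i"
      by (simp add: matrix_matrix_mult_def matrix_vector_mult_def P_def)
    also have "\<dots> = (P ** D) $ i $ j"
      by (simp add: d matrix_matrix_mult_def P_def D_def mult.commute if_distrib[of "\<lambda>x. _ * x"] cong: if_cong)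
    finally show ?thesis .
  qed
  then have "A ** P = P ** D" by (simp add: vec_eq_iff)
  then have "A ** (P ** matrix_inv P) = P ** D ** matrix_inv P"
    by (simp add: matrix_mul_assoc)
  then have "A = P ** D ** matrix_inv P"
    by (simp add: matrix_inv_right[OF P])
  moreover have "diagonal_matrix D" by (simp add: diagonal_matrix_def D_def)
  ultimately show ?thesis
    using P unfolding diagonalizable_def similar_matrix_def by blast
qed

lemma diagonalizable_if_annihilated:
  fixes A :: "'a::field^'n^'n"
  assumes "finite S" "c \<noteq> 0" "matpoly (smult c (\<Prod>\<mu>\<in>S. [:-\<mu>, 1:])) A = 0"
  shows "diagonalizable A"
proof (rule diagonalizable_if_eigenvectors_span)
  have "matpoly (\<Prod>\<mu>\<in>S. [:-\<mu>, 1:]) A = matpoly (smult (inverse c) (smult c (\<Prod>\<mu>\<in>S. [:-\<mu>, 1:]))) A"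
    using assms(2) by simp
  also have "\<dots> = 0"
    unfolding matpoly_smult[of "inverse c"] assms(3) by (simp add: vec_eq_iff mat_mult_entry)
  finally have "matpoly (\<Prod>\<mu>\<in>S. [:-\<mu>, 1:]) A = 0" .
  then have "v \<in> vec.span (\<Union>\<mu>\<in>S. {v. A *v v = \<mu> *s v})" for v
    by (intro kernel_subset_eigenvector_span assms(1)) simp
  moreover have "vec.span (\<Union>\<mu>\<in>S. {v. A *v v = \<mu> *s v}) \<subseteq> vec.span {v. \<exists>\<mu>. A *v v = \<mu> *s v}"
    by (rule vec.span_mono) auto
  ultimately show "vec.span {v. \<exists>\<mu>. A *v v = \<mu> *s v} = UNIV" by blast
qed

lemma coeff_sum_monom: "coeff (\<Sum>i<k. monom (c i) i) n = (if n < k then c n else 0)"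
  by (simp add: coeff_sum)

text \<open>
  The powers up to the dimension of the matrix space are too many to be linearly independent. The
  bound does not depend on \<open>A\<close>, and this makes the union over the degree finite.
\<close>

lemma ex_annihilating_poly:
  fixes A :: "real^'n^'n"
  shows "\<exists>p. p \<noteq> 0 \<and> degree p \<le> DIM(real^'n^'n) \<and> matpoly p A = 0"
proof (rule ccontr)
  define N where "N = DIM(real^'n^'n)"
  define f where "f = (\<lambda>i. matpoly (monom 1 i) A)"
  assume "\<not> ?thesis"
  then have no: "matpoly p A \<noteq> 0" if "p \<noteq> 0" "degree p < Suc N" for p
    using that unfolding N_def less_Suc_eq_le by blast
  have lincomb: "(\<Sum>i<Suc N. u i *\<^sub>R f i) \<noteq> 0" if "i < Suc N" "u i \<noteq> 0" for u i
  proof -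
    let ?p = "\<Sum>i<Suc N. monom (u i) i"
    have "matpoly ?p A = (\<Sum>i<Suc N. matpoly (smult (u i) (monom 1 i)) A)"
      unfolding matpoly_sum smult_monom by simp
    also have "\<dots> = (\<Sum>i<Suc N. u i *\<^sub>R f i)"
      unfolding matpoly_smult f_def by (intro sum.cong refl) (simp add: vec_eq_iff mat_mult_entry)
    finally have "(\<Sum>i<Suc N. u i *\<^sub>R f i) = matpoly ?p A" by simp
    moreover have "?p \<noteq> 0"
      using coeff_sum_monom[of u "Suc N" i] that by (metis coeff_0)
    moreover have "degree ?p < Suc N"
      unfolding less_Suc_eq_le by (rule degree_le) (simp only: coeff_sum_monom, simp)
    ultimately show ?thesis using no by metis
  qed
  \<comment> \<open>Distinct exponents give distinct powers, so that the set of powers has \<open>Suc N\<close> elements.\<close>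
  have inj: "inj_on f {..<Suc N}"
  proof (rule inj_onI, rule ccontr)
    fix i j assume ij: "i \<in> {..<Suc N}" "j \<in> {..<Suc N}" "f i = f j" "i \<noteq> j"
    define u where "u = (\<lambda>l. if l = i then 1 else if l = j then -1 else (0::real))"
    have "(\<Sum>l<Suc N. u l *\<^sub>R f l) = (\<Sum>l\<in>{i, j}. u l *\<^sub>R f l)"
      using ij by (intro sum.mono_neutral_right) (auto simp: u_def)
    also have "\<dots> = 0" using ij by (simp add: u_def)
    finally show False using lincomb[of i u] ij by (simp add: u_def)
  qed
  have "independent (f ` {..<Suc N})"
  proof (rule ccontr)
    assume "\<not> ?thesis"
    then obtain u v where u: "v \<in> f ` {..<Suc N}" "u v \<noteq> 0" "(\<Sum>v\<in>f ` {..<Suc N}. u v *\<^sub>R v) = 0"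
      using dependent_finite[of "f ` {..<Suc N}"] by auto
    then obtain i where "i < Suc N" "u (f i) \<noteq> 0" by auto
    then have "(\<Sum>i<Suc N. u (f i) *\<^sub>R f i) \<noteq> 0" by (rule lincomb)
    with u(3) inj show False by (simp add: sum.reindex)
  qed
  then have "card (f ` {..<Suc N}) \<le> N" unfolding N_def using independent_bound by blast
  with inj show False by (simp add: card_image)
qed

section \<open>Roots of real polynomials\<close>

abbreviation cpoly :: "real poly \<Rightarrow> complex poly" where
  "cpoly \<equiv> map_poly complex_of_real"

lemma cpoly_add: "cpoly (p + q) = cpoly p + cpoly q"
  by (rule poly_eqI) (simp add: coeff_map_poly)

lemma cpoly_mult: "cpoly (p * q) = cpoly p * cpoly q"
  by (rule poly_eqI) (simp add: coeff_map_poly coeff_mult)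

lemma cpoly_smult: "cpoly (smult a p) = smult (of_real a) (cpoly p)"
  by (rule poly_eqI) (simp add: coeff_map_poly)

lemma cpoly_monom: "cpoly (monom a n) = monom (of_real a) n"
  by (rule poly_eqI) (simp add: coeff_map_poly)

lemma cpoly_prod_linear: "cpoly (\<Prod>x\<in>S. [:-x, 1:]) = (\<Prod>x\<in>S. [:- of_real x, 1:])"
  by (induction S rule: infinite_finite_induct)
     (simp_all add: cpoly_mult map_poly_pCons map_poly_1 del: mult_pCons_left)

lemma cpoly_eq_iff: "cpoly p = cpoly q \<longleftrightarrow> p = q"
  by (auto simp: poly_eq_iff coeff_map_poly)

lemma poly_cpoly_of_real: "poly (cpoly p) (of_real x) = of_real (poly p x)"
  by (induction p) (simp_all add: map_poly_pCons)

text \<open>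
  The quadratic is \<open>(x - z) (x - cnj z)\<close>. The remainder of \<open>p\<close> has degree at most one and vanishes
  at the nonreal number \<open>z\<close>, so it is zero.
\<close>

lemma quadratic_dvd_of_nonreal_root:
  fixes p :: "real poly"
  assumes root: "poly (cpoly p) z = 0" and z: "Im z \<noteq> 0"
  shows "[:(Re z)\<^sup>2 + (Im z)\<^sup>2, - 2 * Re z, 1:] dvd p"
proof -
  define g where "g = [:(Re z)\<^sup>2 + (Im z)\<^sup>2, - 2 * Re z, 1:]"
  have gz: "poly (cpoly g) z = 0"
    by (simp add: g_def map_poly_pCons complex_eq_iff power2_eq_square algebra_simps)
  have "degree (p mod g) < 2 \<or> p mod g = 0"
    using degree_mod_less[of g p] by (auto simp: g_def)
  then have "degree (p mod g) \<le> 1" by auto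
  then obtain u v where r: "p mod g = [:u, v:]"
  proof (cases "p mod g")
    case (pCons u r)
    with \<open>degree (p mod g) \<le> 1\<close> have "degree r = 0" by (auto split: if_splits)
    then obtain v where "r = [:v:]" by (rule degree_eq_zeroE)
    with pCons show ?thesis using that by simp
  qed
  have "cpoly p = cpoly g * cpoly (p div g) + cpoly (p mod g)"
    by (simp flip: cpoly_mult cpoly_add)
  then have "poly (cpoly (p mod g)) z = 0" using root gz by simp
  then have "complex_of_real u + z * of_real v = 0" by (simp add: r map_poly_pCons)
  then have "v = 0" "u = 0" using z by (auto simp: complex_eq_iff)
  with r have "p mod g = 0" by simp
  then show ?thesis unfolding g_def[symmetric] by (rule mod_0_imp_dvd)
qed

text \<open>
  The minimal polynomial of \<open>z\<close> over the reals. It replaces the linear factor \<open>x - z\<close> in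
  arguments about a real polynomial, and its root at \<open>z\<close> is simple.
\<close>

lemma real_factor_at_complex_root:
  obtains g :: "real poly" where "degree g > 0" "poly (pderiv (cpoly g)) z \<noteq> 0"
    "\<And>p. poly (cpoly p) z = 0 \<Longrightarrow> g dvd p" "poly (cpoly g) z = 0"
proof (cases "Im z = 0")
  case True
  then have z: "z = of_real (Re z)" by (simp add: complex_eq_iff)
  show ?thesis
  proof (rule that[of "[:- Re z, 1:]"])
    show "[:- Re z, 1:] dvd p" if "poly (cpoly p) z = 0" for p
      using that poly_cpoly_of_real[of p "Re z"] z by (simp add: poly_eq_0_iff_dvd[symmetric])
  qed (use z in \<open>auto simp: map_poly_pCons pderiv_pCons complex_eq_iff\<close>)
next
  case False
  show ?thesis
    by (rule that[OF _ _ quadratic_dvd_of_nonreal_root[OF _ False]])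
       (use False in \<open>auto simp: map_poly_pCons pderiv_pCons complex_eq_iff power2_eq_square algebra_simps\<close>)
qed

section \<open>Trace criteria for diagonalizability\<close>

lemma trace_matpoly_mult_eq_0:
  fixes A :: "'a::field^'n^'n"
  assumes "\<And>j. j < k \<Longrightarrow> trace (matpoly (p * monom 1 j) A) = 0" and "degree r < k"
  shows "trace (matpoly (p * r) A) = 0"
proof -
  have "p * r = (\<Sum>j\<le>degree r. smult (coeff r j) (p * monom 1 j))"
    by (subst poly_as_sum_of_monoms[of r, symmetric])
       (simp add: sum_distrib_left smult_monom flip: mult_smult_right)
  then show ?thesis
    using assms by (simp add: trace_matpoly_sum trace_matpoly_smult)
qed

text \<open>
  A multiple complex root of \<open>m\<close> gives a real polynomial \<open>g\<close> with \<open>m = g\<^sup>2 t\<close>. All multiples of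
  \<open>s = g t\<close> then square to zero at \<open>A\<close> and have trace zero, so \<open>s\<close> lies in the radical of the trace
  form, although its degree is less than \<open>k\<close>.
\<close>

lemma rsquarefree_cpoly_annihilator:
  fixes A :: "real^'n^'n"
  assumes nondeg: "\<And>p. p \<noteq> 0 \<Longrightarrow> degree p < k \<Longrightarrow> \<exists>j<k. trace (matpoly (p * monom 1 j) A) \<noteq> 0"
    and m: "m \<noteq> 0" "degree m \<le> k" "matpoly m A = 0"
  shows "rsquarefree (cpoly m)"
  unfolding rsquarefree_roots
proof (intro allI notI, elim conjE)
  fix z assume z: "poly (cpoly m) z = 0" "poly (pderiv (cpoly m)) z = 0"
  obtain g where g: "degree g > 0" "poly (pderiv (cpoly g)) z \<noteq> 0"
      "\<And>p. poly (cpoly p) z = 0 \<Longrightarrow> g dvd p" "poly (cpoly g) z = 0"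
    using real_factor_at_complex_root by blast
  obtain s where s: "m = g * s" using g(3)[OF z(1)] by (rule dvdE)
  have "poly (cpoly s) z = 0"
    using z(2) g(2,4) by (simp add: s cpoly_mult pderiv_mult)
  then obtain t where t: "s = g * t" using g(3) by (metis dvdE)
  have "s \<noteq> 0" "g \<noteq> 0" using m(1) s by auto
  then have "degree s < k" using g(1) m(2) by (simp add: s degree_mult_eq)
  then obtain j where j: "trace (matpoly (s * monom 1 j) A) \<noteq> 0"
    using nondeg \<open>s \<noteq> 0\<close> by blast
  have "(s * monom 1 j) * (s * monom 1 j) = m * (t * monom 1 j * monom 1 j)"
    by (subst (2) t) (simp only: s mult_ac)
  then have "matpoly (s * monom 1 j) A ** matpoly (s * monom 1 j) A = matpoly m A ** matpoly (t * monom 1 j * monom 1 j) A"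
    by (simp only: matpoly_mult[symmetric])
  then have "matpoly (s * monom 1 j) A ** matpoly (s * monom 1 j) A = 0"
    by (simp add: m(3))
  then show False using trace_square_zero j by blast
qed

text \<open>
  From right to left, the annihilator is a product of distinct complex linear factors.
  From left to right, \<open>k\<close> is the least degree of a nonzero annihilator. If \<open>p\<close> is orthogonal to all
  powers below \<open>k\<close>, it is orthogonal to all of \<open>\<real>[A]\<close>, hence
  \<open>\<Sum>i. p(d\<^sub>i) q(d\<^sub>i) = 0\<close> over the eigenvalues \<open>d\<^sub>i\<close>, counted with multiplicity, for each complex polynomial \<open>q\<close>.
  A polynomial \<open>q\<close> that vanishes at all eigenvalues but one shows that \<open>p\<close> vanishes at each
  eigenvalue, so \<open>p(A) = 0\<close>, against the minimality of \<open>k\<close>.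
\<close>

theorem complex_diagonalizable_iff:
  fixes A :: "real^'n^'n"
  shows "diagonalizable (map_matrix complex_of_real A) \<longleftrightarrow>
    (\<exists>k\<le>DIM(real^'n^'n).
       (\<forall>p. p \<noteq> 0 \<longrightarrow> degree p < k \<longrightarrow> (\<exists>j<k. trace (matpoly (p * monom 1 j) A) \<noteq> 0)) \<and>
       (\<exists>m. m \<noteq> 0 \<and> degree m \<le> k \<and> matpoly m A = 0))"
    (is "?L \<longleftrightarrow> ?R")
proof
  assume ?R
  then obtain k m where nondeg: "\<And>p. p \<noteq> 0 \<Longrightarrow> degree p < k \<Longrightarrow> \<exists>j<k. trace (matpoly (p * monom 1 j) A) \<noteq> 0"
    and m: "m \<noteq> 0" "degree m \<le> k" "matpoly m A = 0"
    by blast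
  from nondeg m have "rsquarefree (cpoly m)" by (rule rsquarefree_cpoly_annihilator)
  then have split: "smult (lead_coeff (cpoly m)) (\<Prod>z | poly (cpoly m) z = 0. [:-z, 1:]) = cpoly m"
    by (rule complex_poly_decompose_rsquarefree)
  have "cpoly m \<noteq> 0" using m(1) by (simp add: map_poly_eq_0_iff)
  have "matpoly (cpoly m) (map_matrix complex_of_real A) = 0"
    unfolding map_matrix_of_real_matpoly[symmetric] m(3) by (simp add: vec_eq_iff)
  then show ?L
    using diagonalizable_if_annihilated[of "{z. poly (cpoly m) z = 0}" "lead_coeff (cpoly m)"]
      poly_roots_finite[OF \<open>cpoly m \<noteq> 0\<close>] \<open>cpoly m \<noteq> 0\<close> split by simp
next
  assume ?L
  then obtain P D :: "complex^'n^'n" where D: "diagonal_matrix D" and P: "invertible P"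
    and A: "map_matrix complex_of_real A = P ** D ** matrix_inv P"
    unfolding diagonalizable_def similar_matrix_def by blast
  define ann where "ann = (\<lambda>k. \<exists>m. m \<noteq> 0 \<and> degree m \<le> k \<and> matpoly m A = 0)"
  define k where "k = (LEAST k. ann k)"
  have N: "ann DIM(real^'n^'n)" unfolding ann_def by (rule ex_annihilating_poly)
  then have "ann k" "k \<le> DIM(real^'n^'n)" unfolding k_def by (auto intro: LeastI Least_le)
  then obtain m where m: "m \<noteq> 0" "degree m \<le> k" "matpoly m A = 0" unfolding ann_def by blast
  have "\<exists>j<k. trace (matpoly (p * monom 1 j) A) \<noteq> 0" if p: "p \<noteq> 0" "degree p < k" for p
  proof (rule ccontr)
    assume "\<not> ?thesis"
    then have zero: "trace (matpoly (p * monom 1 j) A) = 0" if "j < k" for j using that by blast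
    have zero_all: "trace (matpoly (p * q) A) = 0" for q
    proof -
      have "p * q = m * (p * (q div m)) + p * (q mod m)"
        by (metis distrib_left mult.left_commute mult_div_mod_eq)
      then have "matpoly (p * q) A = matpoly (p * (q mod m)) A"
        by (simp add: matpoly_add matpoly_mult[of m] m(3))
      moreover have "degree (q mod m) < k"
        using degree_mod_less[OF m(1), of q] m(2) p(2) by auto
      ultimately show ?thesis using trace_matpoly_mult_eq_0[OF zero] by metis
    qed
    \<comment> \<open>Orthogonality to all powers extends linearly from real to complex polynomials.\<close>
    define P' where "P' = poly (cpoly p)"
    define d where "d = (\<lambda>i. D $ i $ i)"
    have pow: "(\<Sum>i\<in>UNIV. P' (d i) * d i ^ j) = 0" for j
    proof -
      have "complex_of_real (trace (matpoly (p * monom 1 j) A)) =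
          trace (matpoly (cpoly p * monom 1 j) (map_matrix complex_of_real A))"
        by (simp add: map_matrix_of_real_matpoly cpoly_mult cpoly_monom flip: trace_map_matrix_of_real)
      then show ?thesis
        by (simp add: zero_all trace_matpoly_similar_diagonal[OF D P A] poly_monom P'_def d_def)
    qed
    have poly: "(\<Sum>i\<in>UNIV. P' (d i) * poly q (d i)) = 0" for q
    proof -
      have "(\<Sum>i\<in>UNIV. P' (d i) * poly q (d i)) =
          (\<Sum>i\<in>UNIV. \<Sum>j\<le>degree q. coeff q j * (P' (d i) * d i ^ j))"
        by (simp add: poly_altdef sum_distrib_left mult_ac)
      also have "\<dots> = (\<Sum>j\<le>degree q. coeff q j * (\<Sum>i\<in>UNIV. P' (d i) * d i ^ j))"
        by (subst sum.swap) (simp add: sum_distrib_left)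
      finally show ?thesis by (simp add: pow)
    qed
    have "\<not> ann (degree p)" using p(2) not_less_Least unfolding k_def by blast
    then have "matpoly p A \<noteq> 0" using p(1) unfolding ann_def by blast
    then have "matpoly (cpoly p) (map_matrix complex_of_real A) \<noteq> 0"
      by (simp add: vec_eq_iff flip: map_matrix_of_real_matpoly)
    then obtain i where i: "P' (d i) \<noteq> 0"
      using matpoly_similar_diagonal_eq_0[OF D P A] unfolding P'_def d_def by blast
    define q where "q = (\<Prod>\<mu>\<in>range d - {d i}. [:-\<mu>, 1:])"
    have q: "poly q (d l) = 0 \<longleftrightarrow> d l \<noteq> d i" for l
      by (auto simp: q_def poly_prod)
    have "(\<Sum>l\<in>UNIV. P' (d l) * poly q (d l)) = (\<Sum>l | d l = d i. P' (d l) * poly q (d l))"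
      by (rule sum.mono_neutral_right) (auto simp: q)
    also have "\<dots> = of_nat (card {l. d l = d i}) * (P' (d i) * poly q (d i))"
      by simp
    also have "\<dots> \<noteq> 0" using i q[of i] by (auto simp: card_eq_0_iff)
    finally show False using poly by blast
  qed
  then show ?R using \<open>k \<le> DIM(real^'n^'n)\<close> m by blast
qed

text \<open>
  A positive definite trace form is nondegenerate, which excludes multiple roots of the annihilator.
  A nonreal root \<open>z = a + b i\<close> is excluded because \<open>m = ((x - a)\<^sup>2 + b\<^sup>2) s\<close> implies
  \<open>((x - a) s)\<^sup>2 + (b s)\<^sup>2 = m s\<close>: the right side is zero at \<open>A\<close>, whereas \<open>(x - a) s\<close> and \<open>b s\<close>
  are nonzero of degree below \<open>k\<close>, so that their squares have positive trace at \<open>A\<close>. Conversely,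
  in an eigenbasis the trace of \<open>p(A)\<^sup>2\<close> is a sum of squares of real numbers.
\<close>

theorem real_diagonalizable_iff:
  fixes A :: "real^'n^'n"
  shows "diagonalizable A \<longleftrightarrow>
    (\<exists>k\<le>DIM(real^'n^'n).
       (\<forall>p. p \<noteq> 0 \<longrightarrow> degree p < k \<longrightarrow> 0 < trace (matpoly (p * p) A)) \<and>
       (\<exists>m. m \<noteq> 0 \<and> degree m \<le> k \<and> matpoly m A = 0))"
    (is "?L \<longleftrightarrow> ?R")
proof
  assume ?R
  then obtain k m where pos: "\<And>p. p \<noteq> 0 \<Longrightarrow> degree p < k \<Longrightarrow> 0 < trace (matpoly (p * p) A)"
    and m: "m \<noteq> 0" "degree m \<le> k" "matpoly m A = 0"
    by blast
  have "\<exists>j<k. trace (matpoly (p * monom 1 j) A) \<noteq> 0" if "p \<noteq> 0" "degree p < k" for p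
    using pos[OF that] trace_matpoly_mult_eq_0[of k p A p] that(2) by force
  then have "rsquarefree (cpoly m)" using m by (rule rsquarefree_cpoly_annihilator)
  then have split: "smult (lead_coeff (cpoly m)) (\<Prod>z | poly (cpoly m) z = 0. [:-z, 1:]) = cpoly m"
    by (rule complex_poly_decompose_rsquarefree)
  have real: "Im z = 0" if z: "poly (cpoly m) z = 0" for z
  proof (rule ccontr)
    assume "Im z \<noteq> 0"
    define g where "g = [:(Re z)\<^sup>2 + (Im z)\<^sup>2, - 2 * Re z, 1:]"
    have "g dvd m" unfolding g_def by (rule quadratic_dvd_of_nonreal_root) fact+
    then obtain s where s: "m = g * s" by (rule dvdE)
    define h where "h = [:- Re z, 1:] * s"
    have "s \<noteq> 0" "g \<noteq> 0" using s m(1) by auto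
    then have "degree m = 2 + degree s" "degree h = 1 + degree s"
      unfolding s h_def by (subst degree_mult_eq; simp add: g_def)+
    moreover from this have "h \<noteq> 0" by auto
    ultimately have "0 < trace (matpoly (h * h) A)" "0 < trace (matpoly (s * s) A)"
      using pos m(2) \<open>s \<noteq> 0\<close> by auto
    then have "0 < trace (matpoly (h * h + smult ((Im z)\<^sup>2) (s * s)) A)"
      by (simp add: trace_matpoly_add trace_matpoly_smult add_pos_nonneg)
    moreover have "h * h + smult ((Im z)\<^sup>2) (s * s) = m * s"
    proof -
      define L where "L = [:- Re z, 1:]"
      have "g = L * L + [:(Im z)\<^sup>2:]"
        by (simp add: g_def L_def power2_eq_square)
      then have "m * s = (L * s) * (L * s) + [:(Im z)\<^sup>2:] * (s * s)"
        by (simp only: s ring_distribs mult_ac)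
      then show ?thesis by (simp add: h_def L_def[symmetric])
    qed
    ultimately show False by (simp add: matpoly_mult[of m] m(3) trace_0[simplified])
  qed
  define S where "S = {x. poly m x = 0}"
  have "{z. poly (cpoly m) z = 0} = complex_of_real ` S"
  proof (intro equalityI subsetI)
    fix z assume z: "z \<in> {z. poly (cpoly m) z = 0}"
    then have "z = of_real (Re z)" using real by (simp add: complex_eq_iff)
    with z show "z \<in> complex_of_real ` S"
      unfolding S_def by (metis (mono_tags) imageI mem_Collect_eq of_real_eq_0_iff poly_cpoly_of_real)
  qed (auto simp: S_def poly_cpoly_of_real)
  then have "cpoly m = smult (of_real (lead_coeff m)) (\<Prod>x\<in>S. [:- of_real x, 1:])"
    using split by (simp add: prod.reindex inj_on_def coeff_map_poly degree_map_poly)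
  then have "m = smult (lead_coeff m) (\<Prod>x\<in>S. [:- x, 1:])"
    by (simp only: cpoly_eq_iff flip: cpoly_prod_linear cpoly_smult)
  then show ?L
    using diagonalizable_if_annihilated[of S "lead_coeff m" A] m poly_roots_finite[OF m(1)]
    unfolding S_def by simp
next
  assume ?L
  then obtain P D :: "real^'n^'n" where D: "diagonal_matrix D" and P: "invertible P"
    and A: "A = P ** D ** matrix_inv P"
    unfolding diagonalizable_def similar_matrix_def by blast
  define ann where "ann = (\<lambda>k. \<exists>m. m \<noteq> 0 \<and> degree m \<le> k \<and> matpoly m A = 0)"
  define k where "k = (LEAST k. ann k)"
  have N: "ann DIM(real^'n^'n)" unfolding ann_def by (rule ex_annihilating_poly)
  then have k: "ann k" "k \<le> DIM(real^'n^'n)" unfolding k_def by (auto intro: LeastI Least_le)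
  have "0 < trace (matpoly (p * p) A)" if p: "p \<noteq> 0" "degree p < k" for p
  proof -
    have "\<not> ann (degree p)" using p(2) not_less_Least unfolding k_def by blast
    then have "matpoly p A \<noteq> 0" using p(1) unfolding ann_def by blast
    then obtain i where "poly p (D $ i $ i) \<noteq> 0"
      using matpoly_similar_diagonal_eq_0[OF D P A] by blast
    then have "0 < (\<Sum>i\<in>UNIV. poly p (D $ i $ i) * poly p (D $ i $ i))"
      by (intro sum_pos2[of _ i]) (auto simp: zero_less_mult_iff)
    then show ?thesis by (simp add: trace_matpoly_similar_diagonal[OF D P A])
  qed
  then show ?R using k unfolding ann_def by blast
qed

section \<open>Semialgebraicity\<close>

text \<open>
  Translates quantification over polynomials, in which the trace criteria are phrased, into
  quantification over coefficient vectors, as in the lemmas on quadratic forms.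
\<close>

lemma all_poly_degree_less_iff:
  "(\<forall>p. p \<noteq> 0 \<longrightarrow> degree p < k \<longrightarrow> R p) \<longleftrightarrow>
   (\<forall>c. (\<exists>i<k. c i \<noteq> 0) \<longrightarrow> R (\<Sum>i<k. monom (c i) i))"
proof (intro iffI allI impI)
  fix c :: "nat \<Rightarrow> 'a"
  assume R: "\<forall>p. p \<noteq> 0 \<longrightarrow> degree p < k \<longrightarrow> R p" and "\<exists>i<k. c i \<noteq> 0"
  then obtain i where i: "i < k" "c i \<noteq> 0" by blast
  have "(\<Sum>i<k. monom (c i) i) \<noteq> 0"
    using coeff_sum_monom[of c k i] i by (metis coeff_0)
  moreover have "degree (\<Sum>i<k. monom (c i) i) \<le> k - 1"
    by (rule degree_le) (auto simp: coeff_sum_monom)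
  ultimately show "R (\<Sum>i<k. monom (c i) i)" using R i by auto
next
  fix p :: "'a poly"
  assume R: "\<forall>c. (\<exists>i<k. c i \<noteq> 0) \<longrightarrow> R (\<Sum>i<k. monom (c i) i)" and p: "p \<noteq> 0" "degree p < k"
  have "(\<Sum>i<k. monom (coeff p i) i) = p"
    using p(2) by (intro poly_eqI) (auto simp: coeff_sum_monom coeff_eq_0)
  moreover have "coeff p (degree p) \<noteq> 0" using p(1) by simp
  ultimately show "R p" using R p(2) by metis
qed

lemma real_polynomial_function_matpoly_monom:
  "real_polynomial_function (\<lambda>A::real^'n^'n. matpoly (monom 1 n) A $ i $ j)"
proof (induction n arbitrary: i j)
  case 0
  have "matpoly (monom 1 0) A $ i $ j = (mat 1 :: real^'n^'n) $ i $ j" for A :: "real^'n^'n"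
    by (simp add: monom_0)
  then show ?case by (simp only: real_polynomial_function.intros(2))
next
  case (Suc n)
  have "bounded_linear (\<lambda>A::real^'n^'n. A $ i $ l)" for l
    by (intro bounded_linear_compose[OF bounded_linear_vec_nth] bounded_linear_vec_nth)
  then have "real_polynomial_function (\<lambda>A::real^'n^'n. \<Sum>l\<in>UNIV. A $ i $ l * matpoly (monom 1 n) A $ l $ j)"
    by (intro real_polynomial_function_sum real_polynomial_function.intros(1,4) Suc finite)
  then show ?case by (simp add: monom_Suc matrix_matrix_mult_def)
qed

lemma real_polynomial_function_trace_matpoly_monom:
  "real_polynomial_function (\<lambda>A::real^'n^'n. trace (matpoly (monom 1 n) A))"
  unfolding trace_def
  by (intro real_polynomial_function_sum real_polynomial_function_matpoly_monom finite)

lemma semialgebraic_ex_annihilator: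
  "semialgebraic {A :: real^'n^'n. \<exists>m. m \<noteq> 0 \<and> degree m \<le> k \<and> matpoly m A = 0}"
proof -
  have entry: "matpoly (\<Sum>i<Suc k. monom (c i) i) A $ a $ b = (\<Sum>i<Suc k. c i * matpoly (monom 1 i) A $ a $ b)"
    for c a b and A :: "real^'n^'n"
  proof -
    have "matpoly (\<Sum>i<Suc k. monom (c i) i) A = (\<Sum>i<Suc k. matpoly (smult (c i) (monom 1 i)) A)"
      unfolding matpoly_sum smult_monom by simp
    then show ?thesis by (simp only: sum_component matpoly_smult mat_mult_entry)
  qed
  have "(\<exists>m. m \<noteq> 0 \<and> degree m \<le> k \<and> matpoly m A = 0) \<longleftrightarrow>
      \<not> (\<forall>c. (\<exists>i<Suc k. c i \<noteq> 0) \<longrightarrow>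
         (\<exists>l\<in>UNIV. (\<Sum>i<Suc k. c i * matpoly (monom 1 i) A $ fst l $ snd l) \<noteq> 0))" for A :: "real^'n^'n"
  proof -
    have "(\<exists>m. m \<noteq> 0 \<and> degree m \<le> k \<and> matpoly m A = 0) \<longleftrightarrow>
        \<not> (\<forall>m. m \<noteq> 0 \<longrightarrow> degree m < Suc k \<longrightarrow> matpoly m A \<noteq> 0)"
      by (auto simp: less_Suc_eq_le)
    also have "\<dots> \<longleftrightarrow> \<not> (\<forall>c. (\<exists>i<Suc k. c i \<noteq> 0) \<longrightarrow> matpoly (\<Sum>i<Suc k. monom (c i) i) A \<noteq> 0)"
      unfolding all_poly_degree_less_iff ..
    finally show ?thesis
      by (simp only: vec_eq_iff entry) simp
  qed
  then have "{A :: real^'n^'n. \<exists>m. m \<noteq> 0 \<and> degree m \<le> k \<and> matpoly m A = 0} =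
      - {A. \<forall>c. (\<exists>i<Suc k. c i \<noteq> 0) \<longrightarrow>
         (\<exists>l\<in>UNIV. (\<Sum>i<Suc k. c i * matpoly (monom 1 i) A $ fst l $ snd l) \<noteq> 0)}"
    by (simp only: Collect_neg_eq)
  also have "semialgebraic \<dots>"
    by (intro semialgebraic.Compl semialgebraic_independent real_polynomial_function_matpoly_monom finite)
  finally show ?thesis .
qed

lemma semialgebraic_trace_nondegenerate:
  "semialgebraic {A :: real^'n^'n. \<forall>p. p \<noteq> 0 \<longrightarrow> degree p < k \<longrightarrow> (\<exists>j<k. trace (matpoly (p * monom 1 j) A) \<noteq> 0)}"
proof -
  have "trace (matpoly ((\<Sum>i<k. monom (c i) i) * monom 1 j) A) =
      (\<Sum>i<k. c i * trace (matpoly (monom 1 (i + j)) A))" for c j and A :: "real^'n^'n"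
  proof -
    have "(\<Sum>i<k. monom (c i) i) * monom 1 j = (\<Sum>i<k. smult (c i) (monom 1 (i + j)))"
      by (simp add: sum_distrib_right mult_monom smult_monom)
    then show ?thesis by (simp only: trace_matpoly_sum trace_matpoly_smult)
  qed
  then have "{A :: real^'n^'n. \<forall>p. p \<noteq> 0 \<longrightarrow> degree p < k \<longrightarrow> (\<exists>j<k. trace (matpoly (p * monom 1 j) A) \<noteq> 0)} =
      {A. \<forall>c. (\<exists>i<k. c i \<noteq> 0) \<longrightarrow> (\<exists>j\<in>{..<k}. (\<Sum>i<k. c i * trace (matpoly (monom 1 (i + j)) A)) \<noteq> 0)}"
    unfolding all_poly_degree_less_iff by (simp add: Bex_def)
  also have "semialgebraic \<dots>"
    by (intro semialgebraic_independent real_polynomial_function_trace_matpoly_monom finite_lessThan)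
  finally show ?thesis .
qed

lemma semialgebraic_trace_posdef:
  "semialgebraic {A :: real^'n^'n. \<forall>p. p \<noteq> 0 \<longrightarrow> degree p < k \<longrightarrow> 0 < trace (matpoly (p * p) A)}"
proof -
  have "trace (matpoly ((\<Sum>i<k. monom (c i) i) * (\<Sum>i<k. monom (c i) i)) A) =
      (\<Sum>i<k. \<Sum>j<k. c i * c j * trace (matpoly (monom 1 (i + j)) A))" for c and A :: "real^'n^'n"
  proof -
    have "(\<Sum>i<k. monom (c i) i) * (\<Sum>i<k. monom (c i) i) =
        (\<Sum>i<k. \<Sum>j<k. smult (c i * c j) (monom 1 (i + j)))"
      by (simp add: sum_product mult_monom smult_monom)
    then show ?thesis by (simp only: trace_matpoly_sum trace_matpoly_smult)
  qed
  then have "{A :: real^'n^'n. \<forall>p. p \<noteq> 0 \<longrightarrow> degree p < k \<longrightarrow> 0 < trace (matpoly (p * p) A)} =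
      {A. \<forall>c. (\<exists>i<k. c i \<noteq> 0) \<longrightarrow> 0 < (\<Sum>i<k. \<Sum>j<k. c i * c j * trace (matpoly (monom 1 (i + j)) A))}"
    unfolding all_poly_degree_less_iff by simp
  also have "semialgebraic \<dots>"
    by (intro semialgebraic_posdef real_polynomial_function_trace_matpoly_monom) (simp add: add.commute)
  finally show ?thesis .
qed

theorem proposition4p2:
  shows "semialgebraic (real_diagonalizable_matrices :: (real^'n::finite^'n) set) \<and>
         semialgebraic (complex_diagonalizable_matrices :: (real^'n^'n) set)"
proof
  have "(real_diagonalizable_matrices :: (real^'n^'n) set) = (\<Union>k\<le>DIM(real^'n^'n).
      {A. \<forall>p. p \<noteq> 0 \<longrightarrow> degree p < k \<longrightarrow> 0 < trace (matpoly (p * p) A)} \<inter>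
      {A. \<exists>m. m \<noteq> 0 \<and> degree m \<le> k \<and> matpoly m A = 0})"
    unfolding real_diagonalizable_matrices_def real_diagonalizable_iff by blast
  also have "semialgebraic \<dots>"
    by (intro semialgebraic_finite_UN semialgebraic.Int
        semialgebraic_trace_posdef semialgebraic_ex_annihilator)
  finally show "semialgebraic (real_diagonalizable_matrices :: (real^'n^'n) set)" .
  have "(complex_diagonalizable_matrices :: (real^'n^'n) set) = (\<Union>k\<le>DIM(real^'n^'n).
      {A. \<forall>p. p \<noteq> 0 \<longrightarrow> degree p < k \<longrightarrow> (\<exists>j<k. trace (matpoly (p * monom 1 j) A) \<noteq> 0)} \<inter>
      {A. \<exists>m. m \<noteq> 0 \<and> degree m \<le> k \<and> matpoly m A = 0})"
    unfolding complex_diagonalizable_matrices_def complex_diagonalizable_iff by blast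
  also have "semialgebraic \<dots>"
    by (intro semialgebraic_finite_UN semialgebraic.Int
        semialgebraic_trace_nondegenerate semialgebraic_ex_annihilator)
  finally show "semialgebraic (complex_diagonalizable_matrices :: (real^'n^'n) set)" .
qed

end
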